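(* If $C$ is a closed convex curve in the plane with diameter $D$ and width $w$, then its geometric dilation satisfies $$\delta(C)\;\le\;2\left(\frac{D}{w}\arcsin\frac{w}{D}+\sqrt{\left(\frac{D}{w}\right)^2-1}\right).$$
   Context: A closed convex curve is the boundary of a planar convex body. The diameter is $D=\max\{|pq|:p,q\in C\}$ and the width $w$ is the minimum distance between two parallel lines enclosing $C$. The geometric dilation is $\delta(C)=\sup_{p\neq q\in C} d_C(p,q)/|pq|$, where $d_C(p,q)$ is the length of the shorter arc of $C$ between $p$ and $q$ and $|pq|$ is the Euclidean distance. *)

theory Defs
  imports "HOL-Analysis.Analysis"
begin

definition closed_convex_curve :: "(real^2) set \<Rightarrow> bool" where
  "closed_convex_curve C \<longleftrightarrow>
     (\<exists>K. convex K \<and> compact K \<and> interior K \<noteq> {} \<and> C = frontier K)"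

definition width :: "(real^2) set \<Rightarrow> real" where
  "width C = Inf {setdist {x. u \<bullet> x = a} {x. u \<bullet> x = b} | u a b.
                    u \<noteq> 0 \<and> (\<forall>x\<in>C. a \<le> u \<bullet> x \<and> u \<bullet> x \<le> b)}"

(* Supremum of the lengths of inscribed polygons; infinite if g is not rectifiable. *)
definition curve_length :: "(real \<Rightarrow> 'a::metric_space) \<Rightarrow> ereal" where
  "curve_length g =
     (SUP (n, t) \<in> {(n::nat, t::nat \<Rightarrow> real). mono_on {..n} t \<and> t ` {..n} \<subseteq> {0..1}}.
        ereal (\<Sum>i<n. dist (g (t i)) (g (t (Suc i)))))"

(* On a simple closed curve C, all arcs in C from p to q \<noteq> p trace one of the two
   subarcs of C with these endpoints, so the infimum is the length of the shorter one. *)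
definition curve_dist :: "'a::metric_space set \<Rightarrow> 'a \<Rightarrow> 'a \<Rightarrow> ereal" where
  "curve_dist C p q =
     (INF g \<in> {g. arc g \<and> path_image g \<subseteq> C \<and> pathstart g = p \<and> pathfinish g = q}.
        curve_length g)"

(* Valued in the extended reals so that the supremum is meaningful without
   presupposing that the dilation is finite. *)
definition geometric_dilation :: "'a::metric_space set \<Rightarrow> ereal" where
  "geometric_dilation C =
     (SUP (p, q) \<in> {(p, q). p \<in> C \<and> q \<in> C \<and> p \<noteq> q}. curve_dist C p q / ereal (dist p q))"

end

theory Submission
  imports Defs
begin

text \<open>
  Let \<open>K\<close> be the convex body bounded by \<open>C\<close>, let \<open>p, q \<in> C\<close> and \<open>l = |pq|\<close>. Every direction contains a chord
  of \<open>K\<close> of length \<open>w\<close>: otherwise \<open>K\<close> and its translate by \<open>w\<close> could be strictly separated and \<open>K\<close> would be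
  narrower than \<open>w\<close>. Take such a chord parallel to \<open>pq\<close>. The homothety with ratio \<open>w/l\<close> taking \<open>pq\<close> to that
  chord maps the cap of \<open>K\<close> cut off by \<open>pq\<close> on the other side into \<open>K\<close> itself. Hence in every direction
  the width of the cap is at most \<open>l/w\<close> times the width of \<open>K\<close>. The latter is at most the width of a
  disc of diameter \<open>D\<close> intersected with a central strip of width \<open>w\<close>, whose perimeter is
  \<open>2 D arcsin (w/D) + 2 sqrt (D\<^sup>2 - w\<^sup>2)\<close>. By Cauchy's formula the length of a convex curve is the
  integral of its widths over \<open>[0, \<pi>]\<close>, so the arc of the cap has length at most \<open>l/w\<close> times that perimeter.
  For inscribed polygons Cauchy's formula only needs \<open>\<integral> |s \<bullet> u| = 2 |s|\<close> over the half circle of unit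
  vectors \<open>u\<close> and the fact that a linear functional does not oscillate more than once along a convex curve.
\<close>

section \<open>Orthonormal coordinates and the mean projection of a segment\<close>

lemma real2_orthonormal_completion:
  fixes n :: "real^2"
  assumes "norm n = 1"
  obtains m where "norm m = 1" "n \<bullet> m = 0" "\<And>x. x = (x \<bullet> n) *\<^sub>R n + (x \<bullet> m) *\<^sub>R m"
proof
  let ?m = "vector [- n$2, n$1] :: real^2"
  have n: "n$1 * n$1 + n$2 * n$2 = 1"
    using assms by (simp add: norm_eq_1 inner_vec_def sum_2)
  show "norm ?m = 1"
    using n by (simp add: norm_eq_1 inner_vec_def sum_2 algebra_simps)
  show "n \<bullet> ?m = 0"
    by (simp add: inner_vec_def sum_2)
  fix x :: "real^2"
  have "x$1 = x$1 * (n$1 * n$1 + n$2 * n$2)" "x$2 = x$2 * (n$1 * n$1 + n$2 * n$2)"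
    using n by auto
  then show "x = (x \<bullet> n) *\<^sub>R n + (x \<bullet> ?m) *\<^sub>R ?m"
    by (simp add: vec_eq_iff forall_2 inner_vec_def sum_2 algebra_simps)
qed

lemma norm_orthonormal_coords:
  fixes n m :: "'a::real_inner"
  assumes "norm n = 1" "norm m = 1" "n \<bullet> m = 0" "x = (x \<bullet> n) *\<^sub>R n + (x \<bullet> m) *\<^sub>R m"
  shows "norm x = sqrt ((x \<bullet> n)\<^sup>2 + (x \<bullet> m)\<^sup>2)"
proof -
  have "x \<bullet> x = x \<bullet> ((x \<bullet> n) *\<^sub>R n + (x \<bullet> m) *\<^sub>R m)"
    using assms(4) by simp
  also have "\<dots> = (x \<bullet> n)\<^sup>2 + (x \<bullet> m)\<^sup>2"
    by (simp only: inner_add_right inner_scaleR_right power2_eq_square)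
  finally show ?thesis
    by (simp add: norm_eq_sqrt_inner)
qed

text \<open>Cauchy's formula for one segment with coordinates \<open>(a, b)\<close>. A phase shift
  turns the integrand into \<open>\<bar>R * sin (t - s)\<bar>\<close>, and on either side of
  \<open>s\<close> the sine keeps its sign and has an explicit antiderivative.\<close>

lemma has_integral_abs_sin_cos:
  fixes a b :: real
  shows "((\<lambda>t. \<bar>a * cos t + b * sin t\<bar>) has_integral 2 * sqrt (a\<^sup>2 + b\<^sup>2)) {0..pi}"
proof -
  \<comment> \<open>This sign makes \<open>- a / R\<close> nonnegative, so that the phase
    \<open>s\<close> can be found in \<open>[0, pi]\<close>.\<close>
  define R where "R = (if a \<le> 0 then 1 else - 1) * sqrt (a\<^sup>2 + b\<^sup>2)"
  have R2: "R\<^sup>2 = a\<^sup>2 + b\<^sup>2" "\<bar>R\<bar> = sqrt (a\<^sup>2 + b\<^sup>2)"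
    by (auto simp: R_def abs_mult)
  obtain s where s: "0 \<le> s" "s \<le> pi" "a = - (R * sin s)" "b = R * cos s"
  proof (cases "R = 0")
    case True
    then show ?thesis using R2 that[of 0] by (auto simp: sum_power2_eq_zero_iff)
  next
    case False
    have "0 \<le> - a / R"
      by (auto simp: R_def divide_le_0_iff zero_le_divide_iff)
    moreover have "(b / R)\<^sup>2 + (- a / R)\<^sup>2 = 1"
    proof -
      have "a\<^sup>2 + b\<^sup>2 \<noteq> 0" using False R2(1) by (metis zero_eq_power2)
      then show ?thesis
        using R2(1) by (simp add: power_divide add_divide_distrib [symmetric] add.commute)
    qed
    ultimately obtain s where "0 \<le> s" "s \<le> pi" "b / R = cos s" "- a / R = sin s"
      using sincos_total_pi by metis
    then show ?thesis using that[of s] False by (simp add: field_simps)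
  qed
  have eq: "a * cos t + b * sin t = R * sin (t - s)" for t
    by (simp add: s(3,4) sin_diff algebra_simps)
  have "((\<lambda>t. \<bar>R\<bar> * sin (s - t)) has_integral \<bar>R\<bar> * cos (s - s) - \<bar>R\<bar> * cos (s - 0)) {0..s}"
    by (rule fundamental_theorem_of_calculus)
       (auto simp: s intro!: derivative_eq_intros simp flip: has_real_derivative_iff_has_vector_derivative)
  then have 1: "((\<lambda>t. \<bar>a * cos t + b * sin t\<bar>) has_integral \<bar>R\<bar> - \<bar>R\<bar> * cos s) {0..s}"
  proof (rule has_integral_eq[rotated, THEN has_integral_eq_rhs])
    fix t assume "t \<in> {0..s}"
    then have "sin (s - t) \<ge> 0" using s by (intro sin_ge_zero) auto
    then show "\<bar>R\<bar> * sin (s - t) = \<bar>a * cos t + b * sin t\<bar>"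
      using sin_minus[of "s - t"] unfolding eq abs_mult by simp
  qed simp
  have "((\<lambda>t. \<bar>R\<bar> * sin (t - s)) has_integral - \<bar>R\<bar> * cos (pi - s) - - \<bar>R\<bar> * cos (s - s)) {s..pi}"
    by (rule fundamental_theorem_of_calculus)
       (auto simp: s intro!: derivative_eq_intros simp flip: has_real_derivative_iff_has_vector_derivative)
  then have 2: "((\<lambda>t. \<bar>a * cos t + b * sin t\<bar>) has_integral \<bar>R\<bar> + \<bar>R\<bar> * cos s) {s..pi}"
  proof (rule has_integral_eq[rotated, THEN has_integral_eq_rhs])
    fix t assume "t \<in> {s..pi}"
    then have "sin (t - s) \<ge> 0" using s by (intro sin_ge_zero) auto
    then show "\<bar>R\<bar> * sin (t - s) = \<bar>a * cos t + b * sin t\<bar>"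
      unfolding eq abs_mult by simp
  qed simp
  show ?thesis
    using has_integral_combine[OF s(1,2) 1 2] R2 by simp
qed

section \<open>Widths and perimeter of the disc cut by a strip\<close>

text \<open>Width in direction \<open>t\<close> of the disc of radius \<open>D/2\<close> intersected with the strip \<open>\<bar>x\<bar> \<le> w/2\<close>, for
  \<open>0 \<le> t \<le> \<pi>\<close>: it is attained on the circular part if \<open>\<bar>cos t\<bar> \<le> w/D\<close> and at a corner otherwise.\<close>

definition strip_disc_width :: "real \<Rightarrow> real \<Rightarrow> real \<Rightarrow> real" where
  "strip_disc_width D w t =
     (if \<bar>cos t\<bar> \<le> w / D then D else w * \<bar>cos t\<bar> + sqrt (D\<^sup>2 - w\<^sup>2) * sin t)"

text \<open>Here \<open>(a, b)\<close> stands for a difference of two points of the body. On the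
  circular range Cauchy-Schwarz suffices; otherwise the functional is largest at the corner
  \<open>(w, sqrt (D\<^sup>2 - w\<^sup>2))\<close>, up to signs of the coordinates.\<close>

lemma strip_disc_width_bound:
  fixes D w a b t :: real
  assumes "0 < w" "w \<le> D" and a: "\<bar>a\<bar> \<le> w" and ab: "a\<^sup>2 + b\<^sup>2 \<le> D\<^sup>2" and t: "0 \<le> t" "t \<le> pi"
  shows "\<bar>a * cos t + b * sin t\<bar> \<le> strip_disc_width D w t"
proof -
  have cs: "x * x' + y * y' \<le> D * E" if "x\<^sup>2 + y\<^sup>2 \<le> D\<^sup>2" "x'\<^sup>2 + y'\<^sup>2 \<le> E\<^sup>2" "0 \<le> E" for x x' y y' E :: real
  proof -
    have "(x * x' + y * y')\<^sup>2 \<le> (x\<^sup>2 + y\<^sup>2) * (x'\<^sup>2 + y'\<^sup>2)"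
      using zero_le_power2[of "x * y' - y * x'"] by (simp add: power2_eq_square algebra_simps)
    also have "\<dots> \<le> D\<^sup>2 * E\<^sup>2"
      using that by (intro mult_mono) auto
    finally have "(x * x' + y * y')\<^sup>2 \<le> (D * E)\<^sup>2" by (simp add: power_mult_distrib)
    then show ?thesis using assms that by (meson power2_le_imp_le mult_nonneg_nonneg order_trans less_imp_le)
  qed
  define a' b' c where "a' = \<bar>a\<bar>" "b' = \<bar>b\<bar>" "c = \<bar>cos t\<bar>"
  have s: "sin t \<ge> 0" using t by (simp add: sin_ge_zero)
  have cs1: "c\<^sup>2 + (sin t)\<^sup>2 = 1" by (simp add: a'_b'_c_def)
  have ab': "a'\<^sup>2 + b'\<^sup>2 \<le> D\<^sup>2" "a' \<le> w" using assms by (auto simp: a'_b'_c_def)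
  have "\<bar>a * cos t + b * sin t\<bar> \<le> \<bar>a * cos t\<bar> + \<bar>b * sin t\<bar>" by (rule abs_triangle_ineq)
  also have "\<dots> = a' * c + b' * sin t" using s by (simp add: a'_b'_c_def abs_mult)
  also have "\<dots> \<le> strip_disc_width D w t"
  proof (cases "c \<le> w / D")
    case True
    then show ?thesis
      using cs[OF ab'(1), of c "sin t" 1] cs1 by (simp add: strip_disc_width_def a'_b'_c_def)
  next
    case False
    define S where "S = sqrt (D\<^sup>2 - w\<^sup>2)"
    have S2: "w\<^sup>2 + S\<^sup>2 = D\<^sup>2" and S: "S \<ge> 0"
      using assms by (auto simp: S_def power_mono)
    have "w < c * D" using False assms by (simp add: field_simps)
    then have "w\<^sup>2 < (c * D)\<^sup>2" using assms by (intro power_strict_mono) auto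
    then have "(D * sin t)\<^sup>2 < S\<^sup>2"
    proof -
      have "(sin t)\<^sup>2 = 1 - c\<^sup>2" using cs1 by simp
      then have "(D * sin t)\<^sup>2 = D\<^sup>2 * (1 - c\<^sup>2)" by (simp add: power_mult_distrib)
      then have "(D * sin t)\<^sup>2 = D\<^sup>2 - (c * D)\<^sup>2" by (simp add: power_mult_distrib algebra_simps)
      then show ?thesis using S2 \<open>w\<^sup>2 < (c * D)\<^sup>2\<close> by simp
    qed
    then have "D * sin t < S" using S by (rule power2_less_imp_less)
    then have S0: "0 < S" using s assms by (smt (verit) mult_nonneg_nonneg)
    have "w * (D * sin t) \<le> (c * D) * S"
      using \<open>D * sin t < S\<close> \<open>w < c * D\<close> s assms by (intro mult_mono) auto
    then have "D * (w * sin t) \<le> D * (c * S)" by (simp add: algebra_simps)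
    then have "w * sin t \<le> c * S" using assms by auto
    \<comment> \<open>Certificate for the corner: \<open>a' \<le> w\<close> weighted by
      \<open>c * S - w * sin t\<close>, plus the tangent line
      \<open>a' * w + b' * S \<le> D * D\<close> weighted by \<open>sin t\<close>, gives
      \<open>S\<close> times the claim.\<close>
    then have "(c * S - w * sin t) * a' \<le> (c * S - w * sin t) * w"
      using ab' by (intro mult_left_mono) auto
    moreover have "a' * w + b' * S \<le> D * D"
      using assms by (intro cs[OF ab'(1)]) (auto simp: S2)
    then have "sin t * (a' * w + b' * S) \<le> sin t * (D * D)"
      using s by (rule mult_left_mono)
    moreover have "D * D = w * w + S * S" using S2 by (simp add: power2_eq_square)
    ultimately have "S * (a' * c + b' * sin t) \<le> S * (w * c + S * sin t)"
      by (simp add: algebra_simps)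
    then show ?thesis using False S0 by (simp add: strip_disc_width_def a'_b'_c_def S_def)
  qed
  finally show ?thesis .
qed

text \<open>The branches switch at \<open>pi/2 - al\<close> and \<open>pi/2 + al\<close> with
  \<open>al = arcsin (w / D)\<close>. The middle piece is the constant \<open>D\<close>, and each
  outer piece contributes \<open>S\<close>.\<close>

lemma has_integral_strip_disc_width:
  fixes D w :: real
  assumes "0 < w" "w \<le> D"
  shows "(strip_disc_width D w has_integral 2 * D * arcsin (w / D) + 2 * sqrt (D\<^sup>2 - w\<^sup>2)) {0..pi}"
proof -
  define al S where "al = arcsin (w / D)" and "S = sqrt (D\<^sup>2 - w\<^sup>2)"
  have wD: "0 < w / D" "w / D \<le> 1" using assms by auto
  have al: "0 \<le> al" "al \<le> pi / 2"
    using wD arcsin_le_arcsin[of 0 "w / D"] arcsin_bounded[of "w / D"] by (auto simp: al_def)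
  have "sin al = w / D" unfolding al_def using wD by (intro sin_arcsin) auto
  then have sin_al: "D * sin al = w" using assms by simp
  have cos_al: "D * cos al = S"
  proof -
    have "D * cos al = sqrt (D\<^sup>2) * sqrt (1 - (w / D)\<^sup>2)"
      using wD(2) order_trans[OF _ less_imp_le[OF wD(1)], of "- 1"] assms
      unfolding al_def by (subst cos_arcsin) auto
    also have "\<dots> = S"
    proof -
      have "D\<^sup>2 * (1 - (w / D)\<^sup>2) = D\<^sup>2 - w\<^sup>2" using assms by (simp add: power_divide field_simps)
      then show ?thesis by (simp only: S_def flip: real_sqrt_mult)
    qed
    finally show ?thesis .
  qed
  have eD: "strip_disc_width D w t = D" if "\<bar>cos t\<bar> \<le> sin al" for t
    using that wD by (simp add: strip_disc_width_def al_def)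
  \<comment> \<open>At the switching angles both branches give \<open>D\<close>, so the corner
    formula extends to them and the three pieces can be closed intervals.\<close>
  have eS: "strip_disc_width D w t = w * \<bar>cos t\<bar> + S * sin t" if c: "sin al \<le> \<bar>cos t\<bar>" "0 \<le> t" "t \<le> pi" for t
  proof (cases "\<bar>cos t\<bar> = sin al")
    case True
    have "sin t = cos al"
    proof (rule power2_eq_imp_eq)
      show "(sin t)\<^sup>2 = (cos al)\<^sup>2"
        using True by (metis cos_squared_eq power2_abs sin_squared_eq)
    qed (use that al in \<open>auto intro: sin_ge_zero cos_ge_zero\<close>)
    then have "D = w * \<bar>cos t\<bar> + S * sin t"
    proof -
      have "D = D * sin al * sin al + D * cos al * cos al"
        by (metis distrib_left mult.assoc mult.right_neutral power2_eq_square sin_cos_squared_add)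
      then show ?thesis using True \<open>sin t = cos al\<close> by (simp only: sin_al cos_al)
    qed
    then show ?thesis using eD[of t] True by simp
  next
    case False
    then show ?thesis using that wD by (simp add: strip_disc_width_def al_def S_def)
  qed
  have "((\<lambda>t. w * cos t + S * sin t) has_integral
      (w * sin (pi/2 - al) - S * cos (pi/2 - al)) - (w * sin 0 - S * cos 0)) {0..pi/2 - al}"
    using al by (intro fundamental_theorem_of_calculus)
       (auto intro!: derivative_eq_intros simp flip: has_real_derivative_iff_has_vector_derivative)
  then have 1: "(strip_disc_width D w has_integral S + w * cos al - S * sin al) {0..pi/2 - al}"
  proof (rule has_integral_eq[rotated, THEN has_integral_eq_rhs])
    fix t assume t: "t \<in> {0..pi/2 - al}"
    then have "cos (pi / 2 - al) \<le> cos t" using al by (subst cos_mono_le_eq) auto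
    moreover have "0 \<le> cos t" using t al by (intro cos_ge_zero) auto
    ultimately show "w * cos t + S * sin t = strip_disc_width D w t"
      using eS[of t] t al by (simp add: cos_diff)
  qed (simp add: cos_diff sin_diff)
  have "((\<lambda>t. D) has_integral (pi/2 + al - (pi/2 - al)) * D) {pi/2 - al..pi/2 + al}"
    using al has_integral_const_real[of D "pi/2 - al" "pi/2 + al"] by simp
  then have 2: "(strip_disc_width D w has_integral 2 * al * D) {pi/2 - al..pi/2 + al}"
  proof (rule has_integral_eq[rotated, THEN has_integral_eq_rhs])
    fix t assume t: "t \<in> {pi/2 - al..pi/2 + al}"
    then have "cos t \<le> cos (pi / 2 - al)" "cos (pi / 2 + al) \<le> cos t" using al by (auto simp: cos_mono_le_eq)
    then show "D = strip_disc_width D w t"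
      using eD[of t] by (auto simp: cos_diff cos_add)
  qed simp
  have "((\<lambda>t. - w * cos t + S * sin t) has_integral
      (- w * sin pi - S * cos pi) - (- w * sin (pi/2 + al) - S * cos (pi/2 + al))) {pi/2 + al..pi}"
    using al by (intro fundamental_theorem_of_calculus)
       (auto intro!: derivative_eq_intros simp flip: has_real_derivative_iff_has_vector_derivative)
  then have 3: "(strip_disc_width D w has_integral S + w * cos al - S * sin al) {pi/2 + al..pi}"
  proof (rule has_integral_eq[rotated, THEN has_integral_eq_rhs])
    fix t assume t: "t \<in> {pi/2 + al..pi}"
    then have "cos t \<le> cos (pi / 2 + al)" using al by (subst cos_mono_le_eq) auto
    then have "cos t \<le> - sin al" "0 \<le> sin al" using al by (auto simp: cos_add sin_ge_zero)
    then show "- w * cos t + S * sin t = strip_disc_width D w t"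
      using eS[of t] t al by simp
  qed (simp add: cos_add sin_add)
  have 12: "(strip_disc_width D w has_integral (S + w * cos al - S * sin al) + 2 * al * D) {0..pi/2 + al}"
    using al by (intro has_integral_combine[OF _ _ 1 2]) auto
  have "(strip_disc_width D w has_integral
      (S + w * cos al - S * sin al + 2 * al * D) + (S + w * cos al - S * sin al)) {0..pi}"
    using al by (intro has_integral_combine[OF _ _ 12 3]) auto
  moreover have "w * cos al = S * sin al"
    using sin_al cos_al by (metis mult.assoc mult.commute)
  then have "(S + w * cos al - S * sin al + 2 * al * D) + (S + w * cos al - S * sin al) = 2 * D * al + 2 * S"
    by simp
  ultimately show ?thesis
    unfolding S_def al_def by simp
qed

section \<open>Variation of a sequence that oscillates once\<close>

text \<open>The assumptions say that the closed sequence \<open>h 0, \<dots>, h n\<close> does not alternate between high and low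
  values twice, so each level is crossed at most twice.\<close>

lemma abs_variation_le:
  fixes h :: "nat \<Rightarrow> real"
  assumes "\<And>j k. j \<le> k \<Longrightarrow> k < n \<Longrightarrow> min (h j) (h (Suc k)) \<le> max (h 0) (h k)"
    and "\<And>j k. j \<le> k \<Longrightarrow> k < n \<Longrightarrow> min (h 0) (h k) \<le> max (h j) (h (Suc k))"
    and "\<And>i. i \<le> n \<Longrightarrow> m \<le> h i" "\<And>i. i \<le> n \<Longrightarrow> h i \<le> M"
  shows "(\<Sum>i<n. \<bar>h (Suc i) - h i\<bar>) + \<bar>h n - h 0\<bar> \<le> 2 * (M - m)"
  using assms
proof (induction n arbitrary: m M)
  case 0
  then show ?case using "0"(3)[of 0] "0"(4)[of 0] by simp
next
  case (Suc n)
  have IH: "(\<Sum>i<n. \<bar>h (Suc i) - h i\<bar>) + \<bar>h n - h 0\<bar> \<le> 2 * (M - m)"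
    if "\<And>i. i \<le> n \<Longrightarrow> m \<le> h i" "\<And>i. i \<le> n \<Longrightarrow> h i \<le> M" for m M
    using that Suc.prems(1,2) by (intro Suc.IH) auto
  have b: "m \<le> h i" "h i \<le> M" if "i \<le> Suc n" for i
    using that Suc.prems by auto
  \<comment> \<open>A new value above both \<open>h 0\<close> and \<open>h n\<close> rules out
    earlier values above them, so the induction hypothesis applies with the smaller upper bound
    \<open>max (h 0) (h n)\<close>; the low case is dual. A value in between leaves the closed
    variation unchanged.\<close>
  consider "h (Suc n) > max (h 0) (h n)" | "h (Suc n) < min (h 0) (h n)"
    | "h (Suc n) \<le> max (h 0) (h n)" "h (Suc n) \<ge> min (h 0) (h n)" by linarith
  then show ?case
  proof cases
    case 1
    then have "h i \<le> max (h 0) (h n)" if "i \<le> n" for i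
      using Suc.prems(1)[of i n] that by auto
    then have "(\<Sum>i<n. \<bar>h (Suc i) - h i\<bar>) + \<bar>h n - h 0\<bar> \<le> 2 * (max (h 0) (h n) - m)"
      using b by (intro IH) auto
    then show ?thesis using 1 b[of "Suc n"] by auto
  next
    case 2
    then have "min (h 0) (h n) \<le> h i" if "i \<le> n" for i
      using Suc.prems(2)[of i n] that by auto
    then have "(\<Sum>i<n. \<bar>h (Suc i) - h i\<bar>) + \<bar>h n - h 0\<bar> \<le> 2 * (M - min (h 0) (h n))"
      using b by (intro IH) auto
    then show ?thesis using 2 b[of "Suc n"] by auto
  next
    case 3
    then have "\<bar>h (Suc n) - h n\<bar> + \<bar>h (Suc n) - h 0\<bar> = \<bar>h n - h 0\<bar>"
      by (auto simp: max_def min_def split: if_splits)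
    then show ?thesis using IH[of m M] b by simp
  qed
qed

section \<open>Width and diameter of planar sets\<close>

lemma width_le_slab:
  fixes C :: "(real^2) set"
  assumes "u \<noteq> 0" "\<And>x. x \<in> C \<Longrightarrow> a \<le> u \<bullet> x \<and> u \<bullet> x \<le> b" "a \<le> b"
  shows "width C * norm u \<le> b - a"
proof -
  let ?W = "{setdist {x. u \<bullet> x = a} {x. u \<bullet> x = b} | u a b. u \<noteq> 0 \<and> (\<forall>x\<in>C. a \<le> u \<bullet> x \<and> u \<bullet> x \<le> b)}"
  have "bdd_below ?W" by (auto intro!: bdd_belowI[of _ 0])
  then have "width C \<le> setdist {x. u \<bullet> x = a} {x. u \<bullet> x = b}"
    unfolding width_def using assms by (intro cInf_lower) auto
  also have "\<dots> \<le> dist ((a / (u \<bullet> u)) *\<^sub>R u) ((b / (u \<bullet> u)) *\<^sub>R u)"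
    using assms by (intro setdist_le_dist) auto
  also have "\<dots> = \<bar>a / (u \<bullet> u) - b / (u \<bullet> u)\<bar> * norm u"
    by (simp add: dist_norm flip: scaleR_left_diff_distrib)
  also have "\<dots> = (b - a) / (norm u * norm u) * norm u"
    using assms by (simp add: dot_square_norm power2_eq_square field_simps flip: diff_divide_distrib)
  also have "\<dots> = (b - a) / norm u" by simp
  finally show ?thesis using assms by (simp add: field_simps)
qed

lemma setdist_hyperplanes_ge:
  fixes u :: "'a::euclidean_space"
  assumes "u \<noteq> 0" "a \<le> b"
  shows "b - a \<le> setdist {x. u \<bullet> x = a} {x. u \<bullet> x = b} * norm u"
proof -
  have "(b - a) / norm u \<le> setdist {x. u \<bullet> x = a} {x. u \<bullet> x = b}"
  proof (rule le_setdistI)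
    have "(c / (u \<bullet> u)) *\<^sub>R u \<in> {x. u \<bullet> x = c}" for c using assms by auto
    then show "{x. u \<bullet> x = a} \<noteq> {}" "{x. u \<bullet> x = b} \<noteq> {}" by blast+
    fix x y assume "x \<in> {x. u \<bullet> x = a}" "y \<in> {x. u \<bullet> x = b}"
    then have "b - a = u \<bullet> (y - x)" by (simp add: inner_diff_right)
    also have "\<dots> \<le> norm u * dist x y" by (metis dist_commute dist_norm norm_cauchy_schwarz)
    finally show "(b - a) / norm u \<le> dist x y" using assms by (simp add: field_simps)
  qed
  then show ?thesis using assms by (simp add: field_simps)
qed

lemma bounded_slab_exists:
  fixes C :: "(real^2) set"
  assumes "bounded C"
  shows "\<exists>u a b. u \<noteq> 0 \<and> (\<forall>x\<in>C. a \<le> u \<bullet> x \<and> u \<bullet> x \<le> b)"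
proof -
  obtain B where B: "\<And>x. x \<in> C \<Longrightarrow> norm x \<le> B" using assms by (auto simp: bounded_iff)
  have "\<forall>x\<in>C. - B \<le> axis 1 1 \<bullet> x \<and> axis 1 1 \<bullet> x \<le> B"
    using B by (metis abs_le_iff component_le_norm_cart inner_axis' inner_real_def mult_1 order_trans minus_le_iff)
  then show ?thesis by (intro exI[of _ "axis 1 1"]) auto
qed

lemma width_approx:
  fixes C :: "(real^2) set"
  assumes "bounded C" "C \<noteq> {}" "e > 0"
  obtains u where "norm u = 1" "\<And>x y. x \<in> C \<Longrightarrow> y \<in> C \<Longrightarrow> u \<bullet> (x - y) \<le> width C + e"
proof -
  let ?W = "{setdist {x. u \<bullet> x = a} {x. u \<bullet> x = b} | u a b. u \<noteq> 0 \<and> (\<forall>x\<in>C. a \<le> u \<bullet> x \<and> u \<bullet> x \<le> b)}"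
  have "?W \<noteq> {}" using bounded_slab_exists[OF assms(1)] by blast
  moreover have "Inf ?W < width C + e" using assms by (simp add: width_def)
  ultimately obtain z where "z \<in> ?W" "z < width C + e"
    by (rule cInf_lessD[THEN bexE]) auto
  then obtain u a b where u: "u \<noteq> 0" "\<forall>x\<in>C. a \<le> u \<bullet> x \<and> u \<bullet> x \<le> b"
    and w: "setdist {x. u \<bullet> x = a} {x. u \<bullet> x = b} < width C + e" by auto
  obtain x0 where "x0 \<in> C" using assms by auto
  then have ab: "a \<le> b" using u by force
  show ?thesis
  proof
    show "norm (u /\<^sub>R norm u) = 1" using u by simp
    fix x y assume "x \<in> C" "y \<in> C"
    then have "u \<bullet> x \<le> b" "a \<le> u \<bullet> y" using u by auto
    then have "u \<bullet> (x - y) \<le> b - a" by (simp add: inner_diff_right)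
    also have "\<dots> \<le> setdist {x. u \<bullet> x = a} {x. u \<bullet> x = b} * norm u"
      using u ab by (intro setdist_hyperplanes_ge)
    also have "\<dots> \<le> (width C + e) * norm u"
      using w by (intro mult_right_mono) auto
    finally show "(u /\<^sub>R norm u) \<bullet> (x - y) \<le> width C + e"
      using u by (simp add: field_simps)
  qed
qed

text \<open>Unit normals of nearly narrowest slabs have a convergent subsequence on the compact
  circle; its limit is the normal of a narrowest slab.\<close>

lemma width_attained:
  fixes C :: "(real^2) set"
  assumes "bounded C" "C \<noteq> {}"
  obtains u where "norm u = 1" "\<And>x y. x \<in> C \<Longrightarrow> y \<in> C \<Longrightarrow> \<bar>u \<bullet> (x - y)\<bar> \<le> width C"
proof -
  have "\<exists>u. norm u = 1 \<and> (\<forall>x\<in>C. \<forall>y\<in>C. u \<bullet> (x - y) \<le> width C + inverse (Suc n))" for n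
    using width_approx[OF assms, of "inverse (Suc n)"] by (metis inverse_positive_iff_positive of_nat_0_less_iff zero_less_Suc)
  then obtain v where v: "\<And>n. norm (v n) = 1"
    "\<And>n x y. x \<in> C \<Longrightarrow> y \<in> C \<Longrightarrow> v n \<bullet> (x - y) \<le> width C + inverse (Suc n)" by metis
  have "compact (sphere (0::real^2) 1)" by simp
  then obtain u r where u: "u \<in> sphere 0 1" "strict_mono r" "(v \<circ> r) \<longlonglongrightarrow> u"
    using v(1) unfolding compact_eq_seq_compact_metric seq_compact_def by (metis mem_sphere_0)
  have le: "u \<bullet> (x - y) \<le> width C" if "x \<in> C" "y \<in> C" for x y
  proof (rule LIMSEQ_le)
    show "(\<lambda>n. (v \<circ> r) n \<bullet> (x - y)) \<longlonglongrightarrow> u \<bullet> (x - y)"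
      using u by (intro tendsto_intros)
    have "(\<lambda>n. width C + ((\<lambda>n. inverse (real (Suc n))) \<circ> r) n) \<longlonglongrightarrow> width C + 0"
      using u(2) LIMSEQ_inverse_real_of_nat by (intro tendsto_add LIMSEQ_subseq_LIMSEQ) auto
    then show "(\<lambda>n. width C + inverse (real (Suc (r n)))) \<longlonglongrightarrow> width C" by (simp add: o_def)
    show "\<exists>N. \<forall>n\<ge>N. (v \<circ> r) n \<bullet> (x - y) \<le> width C + inverse (real (Suc (r n)))"
      using v(2)[OF that] by auto
  qed
  show ?thesis
  proof
    show "norm u = 1" using u by simp
    fix x y assume "x \<in> C" "y \<in> C"
    then show "\<bar>u \<bullet> (x - y)\<bar> \<le> width C"
      using le[of x y] le[of y x] by (simp add: inner_diff_right abs_le_iff)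
  qed
qed

lemma width_pos:
  fixes C :: "(real^2) set"
  assumes "bounded C" "interior C \<noteq> {}"
  shows "0 < width C"
proof -
  obtain z r where r: "r > 0" "cball z r \<subseteq> C"
    using assms by (meson ex_in_conv mem_interior_cball)
  then have "C \<noteq> {}" by force
  then obtain u where u: "norm u = 1" "\<And>x y. x \<in> C \<Longrightarrow> y \<in> C \<Longrightarrow> \<bar>u \<bullet> (x - y)\<bar> \<le> width C"
    using width_attained assms by metis
  have "z + r *\<^sub>R u \<in> C" "z \<in> C" using r u by (auto simp: subset_iff dist_norm)
  from u(2)[OF this] have "r \<le> width C" using u r by (simp add: abs_mult dot_square_norm)
  then show ?thesis using r by simp
qed

text \<open>Slabs are convex, so a slab contains \<open>C\<close> exactly when it contains the hull.
  This transfers the width from the curve to the body.\<close>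

lemma width_convex_hull:
  fixes C :: "(real^2) set"
  shows "width (convex hull C) = width C"
proof -
  have "(\<forall>x\<in>convex hull C. a \<le> u \<bullet> x \<and> u \<bullet> x \<le> b) \<longleftrightarrow> (\<forall>x\<in>C. a \<le> u \<bullet> x \<and> u \<bullet> x \<le> b)" for u a b
  proof -
    have "convex ({x. u \<bullet> x \<ge> a} \<inter> {x. u \<bullet> x \<le> b})"
      by (intro convex_Int convex_halfspace_le convex_halfspace_ge)
    then have "C \<subseteq> {x. u \<bullet> x \<ge> a} \<inter> {x. u \<bullet> x \<le> b} \<longleftrightarrow> convex hull C \<subseteq> {x. u \<bullet> x \<ge> a} \<inter> {x. u \<bullet> x \<le> b}"
      using hull_minimal hull_subset[of C convex] by blast
    then show ?thesis by (auto simp: subset_iff)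
  qed
  then show ?thesis by (simp add: width_def)
qed

text \<open>Balls are convex, and the argument runs twice: balls around points of \<open>S\<close>
  contain the hull, hence balls around points of the hull contain \<open>S\<close>, hence also the
  hull.\<close>

lemma diameter_convex_hull_eq:
  fixes S :: "'a::real_normed_vector set"
  assumes "bounded S"
  shows "diameter (convex hull S) = diameter S"
proof (rule antisym)
  show "diameter S \<le> diameter (convex hull S)"
    using assms by (intro diameter_subset hull_subset bounded_convex_hull)
  show "diameter (convex hull S) \<le> diameter S"
  proof (rule diameter_le)
    show "convex hull S \<noteq> {} \<or> 0 \<le> diameter S" using diameter_ge_0 assms by blast
    fix x y assume x: "x \<in> convex hull S" and y: "y \<in> convex hull S"
    have "S \<subseteq> cball z (diameter S)" if "z \<in> S" for z
      using that diameter_bounded_bound[OF assms] by auto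
    then have "convex hull S \<subseteq> cball z (diameter S)" if "z \<in> S" for z
      using that by (simp add: hull_minimal)
    then have "S \<subseteq> cball x (diameter S)" using x by (metis dist_commute mem_cball subsetD subsetI)
    then have "convex hull S \<subseteq> cball x (diameter S)" by (simp add: hull_minimal)
    then show "norm (x - y) \<le> diameter S" using y by (auto simp: dist_norm)
  qed
qed

section \<open>Chords of length w and the homothety of a cap\<close>

lemma chord_of_length_width:
  fixes K :: "(real^2) set" and e :: "real^2"
  assumes "convex K" "compact K" "K \<noteq> {}" and e: "norm e = 1"
  obtains a where "a \<in> K" "a + width K *\<^sub>R e \<in> K"
proof (cases "K \<inter> (\<lambda>x. x + width K *\<^sub>R e) ` K = {}")
  case True
  define w where "w = width K"
  have T: "(\<lambda>x. x + w *\<^sub>R e) ` K = (+) (w *\<^sub>R e) ` K" by (simp add: add.commute)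
  then have "convex ((\<lambda>x. x + w *\<^sub>R e) ` K)" "compact ((\<lambda>x. x + w *\<^sub>R e) ` K)"
    using assms by (metis convex_translation, metis compact_translation)
  then obtain u c where "\<forall>x\<in>K. u \<bullet> x < c" "\<forall>x\<in>(\<lambda>x. x + w *\<^sub>R e) ` K. c < u \<bullet> x"
    using separating_hyperplane_closed_compact[of K "(\<lambda>x. x + w *\<^sub>R e) ` K"] assms True
    unfolding w_def by (meson compact_imp_closed image_is_empty)
  then have uc: "\<And>x. x \<in> K \<Longrightarrow> u \<bullet> x < c" "\<And>x. x \<in> K \<Longrightarrow> c < u \<bullet> (x + w *\<^sub>R e)" by auto
  obtain x0 where x0: "x0 \<in> K" "\<And>x. x \<in> K \<Longrightarrow> u \<bullet> x \<le> u \<bullet> x0"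
    using continuous_attains_sup[OF assms(2,3), of "\<lambda>x. u \<bullet> x"] continuous_on_inner[OF continuous_on_const continuous_on_id]
    by blast
  have u0: "u \<noteq> 0" using uc(1)[OF x0(1)] uc(2)[OF x0(1)] by auto
  \<comment> \<open>The translate lies beyond \<open>c\<close>, so \<open>K\<close> lies in the slab
    from \<open>c - w * (u \<bullet> e)\<close> to \<open>u \<bullet> x0 < c\<close>. The bounds
    differ by less than \<open>w * (u \<bullet> e) \<le> w * norm u\<close>, which is too
    narrow.\<close>
  have "w * norm u \<le> u \<bullet> x0 - (c - w * (u \<bullet> e))"
    unfolding w_def
  proof (rule width_le_slab[OF u0])
    show lo: "c - width K * (u \<bullet> e) \<le> u \<bullet> x \<and> u \<bullet> x \<le> u \<bullet> x0" if "x \<in> K" for x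
      using uc(2)[OF that] x0(2)[OF that] by (simp add: w_def inner_add_right)
    show "c - width K * (u \<bullet> e) \<le> u \<bullet> x0" using lo[OF x0(1)] by simp
  qed
  also have "\<dots> < w * (u \<bullet> e)" using uc(1)[OF x0(1)] by simp
  finally have "w * norm u < w * (u \<bullet> e)" .
  moreover have "0 \<le> w"
    unfolding w_def using width_attained[of K] assms by (metis abs_ge_zero all_not_in_conv compact_imp_bounded order_trans)
  moreover have "u \<bullet> e \<le> norm u" using norm_cauchy_schwarz[of u e] e by simp
  ultimately show ?thesis by (smt (verit) mult_left_mono)
next
  case False
  then show ?thesis using that by auto
qed

lemma convex_combination3:
  assumes "convex K" "x \<in> K" "y \<in> K" "z \<in> K" "0 \<le> u" "0 \<le> v" "0 \<le> w" "u + v + w = (1::real)"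
  shows "u *\<^sub>R x + v *\<^sub>R y + w *\<^sub>R z \<in> K"
proof -
  have "u *\<^sub>R x + v *\<^sub>R y + w *\<^sub>R z \<in> convex hull {x, y, z}"
    using assms unfolding convex_hull_3 by blast
  then show ?thesis using assms by (metis hull_minimal insert_subset empty_subsetI subsetD)
qed

text \<open>The map \<open>x \<mapsto> a + (w/l) (x - p)\<close> sends the chord \<open>[p, p + l e]\<close> to the chord \<open>[a, a + w e]\<close>. If it moved
  a point of the cap out of \<open>K\<close>, the triangle spanned by that point and \<open>[a, a + w e]\<close> would meet the
  line through \<open>p\<close> in a segment longer than \<open>l\<close>.\<close>

lemma cap_homothety:
  fixes K :: "'a::real_vector set"
  assumes K: "convex K" and l: "0 < l" and w: "0 < w"
    and line: "\<And>s. p + s *\<^sub>R e \<in> K \<Longrightarrow> 0 \<le> s \<and> s \<le> l"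
    and a: "a \<in> K" "a + w *\<^sub>R e \<in> K" "a = p + a1 *\<^sub>R e - g *\<^sub>R f" "0 < g"
    and x: "x \<in> K" "x = p + al *\<^sub>R e + be *\<^sub>R f" "0 \<le> be"
  shows "a + (w / l) *\<^sub>R (x - p) \<in> K"
proof -
  \<comment> \<open>The weights \<open>s\<close> and \<open>t\<close> cancel the
    \<open>f\<close>-coordinates of \<open>x\<close> and of the chord, so the two points in fact
    \<open>1\<close> lie on the line through \<open>p\<close>, where \<open>line\<close> confines
    them to \<open>[0, l]\<close>.\<close>
  define s t mu where "s = g / (be + g)" and "t = be / (be + g)" and "mu = w / l"
  have st: "s + t = 1" "0 \<le> s" "0 \<le> t" "s * be = t * g" and mu: "mu * l = w" "0 < mu"
    using a x l w by (auto simp: s_def t_def mu_def add_divide_distrib [symmetric] add.commute)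
  have 1: "s *\<^sub>R x + t *\<^sub>R a \<in> K" "s *\<^sub>R x + t *\<^sub>R (a + w *\<^sub>R e) \<in> K"
    using K a x st by (auto intro!: convexD)
  have "s *\<^sub>R x + t *\<^sub>R a = (s + t) *\<^sub>R p + (s * al + t * a1) *\<^sub>R e + (s * be - t * g) *\<^sub>R f"
    unfolding a(3) x(2) by (simp add: algebra_simps)
  then have "s *\<^sub>R x + t *\<^sub>R a = p + (s * al + t * a1) *\<^sub>R e" using st by simp
  then have lo: "0 \<le> s * al + t * a1" using 1 line by metis
  have "s *\<^sub>R x + t *\<^sub>R (a + w *\<^sub>R e) = (s + t) *\<^sub>R p + (s * al + t * (a1 + w)) *\<^sub>R e + (s * be - t * g) *\<^sub>R f"
    unfolding a(3) x(2) by (simp add: algebra_simps)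
  then have "s *\<^sub>R x + t *\<^sub>R (a + w *\<^sub>R e) = p + (s * al + t * (a1 + w)) *\<^sub>R e" using st by simp
  then have hi: "s * al + t * (a1 + w) \<le> l" using 1 line by metis
  \<comment> \<open>\<open>B\<close> is the barycentric weight of \<open>a + w *\<^sub>R e\<close>
    when the image of \<open>x\<close> is written in the triangle spanned by \<open>x\<close> and
    the chord. Its nonnegativity comes from \<open>lo\<close>, that of the weight of
    \<open>a\<close> from \<open>hi\<close>.\<close>
  define B where "B = mu * (s * al + t * a1) / w"
  have B0: "0 \<le> B" using lo mu w by (simp add: B_def)
  have Bw: "B * w = mu * (s * al + t * a1)" using w by (simp add: B_def)
  have "mu * (s * al + t * (a1 + w)) \<le> mu * l" using hi mu by (intro mult_left_mono) auto
  then have "(B + mu * t) * w \<le> 1 * w" using Bw mu by (simp add: algebra_simps)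
  then have A0: "0 \<le> 1 - mu * t - B" using w by simp
  have "(mu * t) *\<^sub>R x + (1 - mu * t - B) *\<^sub>R a + B *\<^sub>R (a + w *\<^sub>R e) \<in> K"
    using st mu A0 B0 a x by (intro convex_combination3[OF K]) auto
  also have "(mu * t) *\<^sub>R x + (1 - mu * t - B) *\<^sub>R a + B *\<^sub>R (a + w *\<^sub>R e)
    = a + (mu * t) *\<^sub>R (x - a) + (B * w) *\<^sub>R e" by (simp add: algebra_simps)
  also have "\<dots> = a + (mu * (t * (al - a1)  + (s * al + t * a1))) *\<^sub>R e + (mu * (t * be + t * g)) *\<^sub>R f"
    unfolding Bw unfolding a(3) x(2) by (simp add: algebra_simps)
  also have "t * (al - a1) + (s * al + t * a1) = (s + t) * al" by (simp add: algebra_simps)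
  also have "t * be + t * g = (s + t) * be" using st(4) by (simp add: algebra_simps)
  also have "a + (mu * ((s + t) * al)) *\<^sub>R e + (mu * ((s + t) * be)) *\<^sub>R f = a + mu *\<^sub>R (x - p)"
    unfolding x(2) st(1) by (simp add: algebra_simps)
  finally show ?thesis by (simp add: mu_def)
qed

section \<open>Radial projection and the arc of a cap\<close>

text \<open>The point arises by shrinking a point of the segment from \<open>a\<close> to
  \<open>b\<close> properly towards \<open>c\<close>. The contrapositive yields
  \<open>1 \<le> x + y\<close> for frontier points.\<close>

lemma mem_interior_triangle:
  fixes c :: "'a::euclidean_space"
  assumes "convex K" "c \<in> interior K" "a \<in> K" "b \<in> K" "0 \<le> x" "0 \<le> y" "x + y < 1"
  shows "c + x *\<^sub>R (a - c) + y *\<^sub>R (b - c) \<in> interior K"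
proof (cases "x + y = 0")
  case True
  then have "x = 0" "y = 0" using assms by auto
  then show ?thesis using assms by simp
next
  case False
  define z where "z = (x / (x + y)) *\<^sub>R a + (y / (x + y)) *\<^sub>R b"
  have "z \<in> K" unfolding z_def
    using assms False by (intro convexD) (auto simp flip: add_divide_distrib)
  then have "z - (1 - (x + y)) *\<^sub>R (z - c) \<in> interior K"
    using assms by (intro mem_interior_convex_shrink) auto
  also have "z - (1 - (x + y)) *\<^sub>R (z - c) = (x + y) *\<^sub>R z + (1 - (x + y)) *\<^sub>R c"
    by (simp add: algebra_simps)
  also have "(x + y) *\<^sub>R z = x *\<^sub>R a + y *\<^sub>R b"
    using False by (simp add: z_def scaleR_add_right)
  finally show ?thesis by (simp add: algebra_simps)
qed

lemma ray_beyond_frontier: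
  fixes c :: "'a::euclidean_space"
  assumes "convex K" "c \<in> interior K" "c + r *\<^sub>R v \<in> frontier K" "0 \<le> r" "c + s *\<^sub>R v \<in> K"
  shows "s \<le> r"
proof (rule ccontr)
  assume "\<not> s \<le> r"
  then have "c + (r / s) *\<^sub>R ((c + s *\<^sub>R v) - c) + 0 *\<^sub>R ((c + s *\<^sub>R v) - c) \<in> interior K"
    using assms by (intro mem_interior_triangle) auto
  then have "c + r *\<^sub>R v \<in> interior K"
    using \<open>\<not> s \<le> r\<close> \<open>0 \<le> r\<close> by simp
  then show False using assms by (simp add: frontier_def)
qed

text \<open>A ray from \<open>c\<close> meets the frontier only once, so central projection is a
  continuous bijection from a compact set to the sphere, and its inverse is continuous.\<close>

lemma radial_projection_inverse:
  fixes c :: "'a::euclidean_space"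
  assumes K: "convex K" "compact K" "c \<in> interior K"
  obtains h where "continuous_on (sphere 0 1) h"
    "\<And>v. norm v = 1 \<Longrightarrow> h v \<in> frontier K"
    "\<And>v. norm v = 1 \<Longrightarrow> \<exists>r>0. h v = c + r *\<^sub>R v"
    "\<And>v r. norm v = 1 \<Longrightarrow> 0 < r \<Longrightarrow> c + r *\<^sub>R v \<in> frontier K \<Longrightarrow> h v = c + r *\<^sub>R v"
proof -
  define N where "N x = (x - c) /\<^sub>R norm (x - c)" for x
  have sub: "frontier K \<subseteq> K" using K by (simp add: compact_imp_closed frontier_subset_closed)
  have ne: "x \<noteq> c" if "x \<in> frontier K" for x using that K by (auto simp: frontier_def)
  have N: "x = c + norm (x - c) *\<^sub>R N x" if "x \<in> frontier K" for x
    using ne[OF that] by (simp add: N_def)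
  have Nv: "N (c + r *\<^sub>R v) = v" if "norm v = 1" "0 < r" for r v
    using that by (simp add: N_def)
  have inj: "inj_on N (frontier K)"
  proof (rule inj_onI)
    fix x y assume x: "x \<in> frontier K" and y: "y \<in> frontier K" and eq: "N x = N y"
    have "norm (x - c) \<le> norm (y - c)"
      using ray_beyond_frontier[OF K(1,3), of "norm (y - c)" "N y" "norm (x - c)"] N[OF x] N[OF y] eq x y sub by auto
    moreover have "norm (y - c) \<le> norm (x - c)"
      using ray_beyond_frontier[OF K(1,3), of "norm (x - c)" "N x" "norm (y - c)"] N[OF x] N[OF y] eq x y sub by auto
    ultimately show "x = y" using N[OF x] N[OF y] eq by simp
  qed
  have im: "N ` frontier K = sphere 0 1"
  proof (intro equalityI subsetI)
    fix v assume "v \<in> N ` frontier K"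
    then show "v \<in> sphere 0 1" using ne by (auto simp: N_def)
  next
    fix v :: 'a assume "v \<in> sphere 0 1"
    then have v: "norm v = 1" "v \<noteq> 0" by auto
    obtain d where "0 < d" "c + d *\<^sub>R v \<in> frontier K"
      using ray_to_frontier[OF compact_imp_bounded[OF K(2)] K(3) v(2)] by metis
    then show "v \<in> N ` frontier K" using Nv[OF v(1)] by (metis image_eqI)
  qed
  have "continuous_on (frontier K) N"
    unfolding N_def using ne by (intro continuous_intros) auto
  then obtain h where "homeomorphism (frontier K) (sphere 0 1) N h"
    using homeomorphism_compact[OF compact_frontier[OF K(2)] _ im inj] by auto
  then have h: "continuous_on (sphere 0 1) h" "h ` sphere 0 1 = frontier K"
    "\<And>x. x \<in> frontier K \<Longrightarrow> h (N x) = x" "\<And>v. v \<in> sphere 0 1 \<Longrightarrow> N (h v) = v"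
    by (auto simp: homeomorphism_def)
  show ?thesis
  proof
    show "continuous_on (sphere 0 1) h" by fact
    fix v :: 'a assume v: "norm v = 1"
    show hv: "h v \<in> frontier K" using v h(2) by force
    show "\<exists>r>0. h v = c + r *\<^sub>R v"
      using N[OF hv] ne[OF hv] h(4)[of v] v by (intro exI[of _ "norm (h v - c)"]) auto
    fix r :: real assume "0 < r" "c + r *\<^sub>R v \<in> frontier K"
    then show "h v = c + r *\<^sub>R v" using h(3) Nv[OF v] by metis
  qed
qed

text \<open>The last property (each point lies on or beyond the chord of two neighbours, seen from \<open>c\<close>) fails only
  for the pair of both end points, whose chord passes through \<open>c\<close>.\<close>

lemma cap_arc:
  fixes K :: "'a::euclidean_space set"
  assumes K: "convex K" "compact K" "c \<in> interior K"
    and ef: "norm e = 1" "norm f = 1" "e \<bullet> f = 0"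
    and r: "0 < r" "c - r *\<^sub>R e \<in> frontier K" "c + r *\<^sub>R e \<in> frontier K"
  obtains g where "arc g" "path_image g \<subseteq> frontier K"
    "pathstart g = c - r *\<^sub>R e" "pathfinish g = c + r *\<^sub>R e"
    "\<And>t. t \<in> {0..1} \<Longrightarrow> \<exists>x y. 0 \<le> y \<and> g t = c + x *\<^sub>R e + y *\<^sub>R f"
    "\<And>s t t'. 0 \<le> s \<Longrightarrow> s \<le> t \<Longrightarrow> t \<le> t' \<Longrightarrow> t' \<le> 1 \<Longrightarrow> 0 < s \<or> t' < 1 \<Longrightarrow>
      \<exists>x y. 0 \<le> x \<and> 0 \<le> y \<and> 1 \<le> x + y \<and> g t - c = x *\<^sub>R (g s - c) + y *\<^sub>R (g t' - c)"
proof -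
  obtain h where h: "continuous_on (sphere 0 1) h"
    "\<And>v. norm v = 1 \<Longrightarrow> h v \<in> frontier K"
    "\<And>v. norm v = 1 \<Longrightarrow> \<exists>r>0. h v = c + r *\<^sub>R v"
    "\<And>v r. norm v = 1 \<Longrightarrow> 0 < r \<Longrightarrow> c + r *\<^sub>R v \<in> frontier K \<Longrightarrow> h v = c + r *\<^sub>R v"
    using radial_projection_inverse[OF K] by blast
  \<comment> \<open>The half circle from \<open>- e\<close> over \<open>f\<close> to
    \<open>e\<close>; its image under \<open>h\<close> is the frontier arc on the side of
    \<open>f\<close>.\<close>
  define v where "v t = - cos (pi * t) *\<^sub>R e + sin (pi * t) *\<^sub>R f" for t
  define g where "g t = h (v t)" for t
  have nv: "norm (v t) = 1" for t
    using ef by (simp add: norm_eq_1 v_def inner_simps inner_commute flip: power2_eq_square)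
  have gf: "g t \<in> frontier K" for t using h(2) nv by (simp add: g_def)
  have gK: "g t \<in> K" for t
    using gf K by (meson compact_imp_closed frontier_subset_closed subsetD)
  have "\<exists>r>0. g t = c + r *\<^sub>R v t" for t using h(3) nv by (simp add: g_def)
  then obtain \<rho> where \<rho>: "\<And>t. 0 < \<rho> t" "\<And>t. g t = c + \<rho> t *\<^sub>R v t" by metis
  have inj: "inj_on g {0..1}"
  proof (rule inj_onI)
    fix s t :: real assume st: "s \<in> {0..1}" "t \<in> {0..1}" "g s = g t"
    then have eq: "\<rho> s *\<^sub>R v s = \<rho> t *\<^sub>R v t" using \<rho>(2) by (metis add_left_cancel)
    then have "norm (\<rho> s *\<^sub>R v s) = norm (\<rho> t *\<^sub>R v t)" by simp
    then have "\<rho> s = \<rho> t" using \<rho>(1)[of s] \<rho>(1)[of t] nv by simp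
    then have "v s \<bullet> e = v t \<bullet> e" using eq \<rho>(1)[of t] by simp
    then have "cos (pi * s) = cos (pi * t)"
      using ef by (auto simp: v_def inner_simps inner_commute norm_eq_1)
    moreover have "0 \<le> pi * s" "pi * s \<le> pi" "0 \<le> pi * t" "pi * t \<le> pi"
      using st by auto
    ultimately show "s = t" using cos_inj_pi[of "pi * s" "pi * t"] by simp
  qed
  show ?thesis
  proof
    have "path g" unfolding path_def g_def
    proof (rule continuous_on_compose2[OF h(1)])
      show "continuous_on {0..1} v" unfolding v_def[abs_def] by (intro continuous_intros)
    qed (auto simp: nv)
    then show "arc g" using inj by (simp add: arc_def)
    show "path_image g \<subseteq> frontier K" using gf by (auto simp: path_image_def)
    show "pathstart g = c - r *\<^sub>R e"
      using h(4)[OF nv r(1), of 0] r by (simp add: pathstart_def g_def v_def)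
    show "pathfinish g = c + r *\<^sub>R e"
      using h(4)[OF nv r(1), of 1] r by (simp add: pathfinish_def g_def v_def)
    show "\<exists>x y. 0 \<le> y \<and> g t = c + x *\<^sub>R e + y *\<^sub>R f" if "t \<in> {0..1}" for t
    proof (intro exI conjI)
      show "g t = c + (- \<rho> t * cos (pi * t)) *\<^sub>R e + (\<rho> t * sin (pi * t)) *\<^sub>R f"
        by (simp add: \<rho>(2) v_def scaleR_diff_right algebra_simps)
      show "0 \<le> \<rho> t * sin (pi * t)"
        using that \<rho>(1)[of t] by (intro mult_nonneg_nonneg sin_ge_zero) auto
    qed
    fix s t t' :: real assume t: "0 \<le> s" "s \<le> t" "t \<le> t'" "t' \<le> 1" "0 < s \<or> t' < 1"
    show "\<exists>x y. 0 \<le> x \<and> 0 \<le> y \<and> 1 \<le> x + y \<and> g t - c = x *\<^sub>R (g s - c) + y *\<^sub>R (g t' - c)"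
    proof (cases "s = t'")
      case True
      then have "t = s" using t by simp
      then show ?thesis by (intro exI[of _ 1] exI[of _ 0]) simp
    next
      case False
      \<comment> \<open>The assumption \<open>0 < s \<or> t' < 1\<close> keeps the angle between
        \<open>v s\<close> and \<open>v t'\<close> below \<open>pi\<close>, so its sine is positive
        and can be divided by.\<close>
      define d where "d = sin (pi * t' - pi * s)"
      have "0 < pi * (t' - s)" "pi * (t' - s) < pi * 1"
        using t False by (auto intro!: mult_pos_pos mult_strict_left_mono)
      then have d: "0 < d" unfolding d_def by (intro sin_gt_zero) (auto simp: algebra_simps)
      \<comment> \<open>Cramer's rule for \<open>v t\<close> in the basis \<open>v s\<close>,
        \<open>v t'\<close>, rescaled by the radii.\<close>
      define x y where "x = \<rho> t * sin (pi * t' - pi * t) / (d * \<rho> s)"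
        and "y = \<rho> t * sin (pi * t - pi * s) / (d * \<rho> t')"
      have sn: "0 \<le> sin (pi * b - pi * a)" if "a \<le> b" "0 \<le> a" "b \<le> 1" for a b
      proof (rule sin_ge_zero)
        have "pi * (b - a) \<le> pi * 1" using that by (intro mult_left_mono) auto
        then show "pi * b - pi * a \<le> pi" by (simp add: algebra_simps)
      qed (use that in auto)
      have xy: "0 \<le> x" "0 \<le> y"
        unfolding x_def y_def using t d \<rho>(1) sn
        by (auto intro!: divide_nonneg_nonneg mult_nonneg_nonneg simp: less_imp_le)
      have "d *\<^sub>R v t = sin (pi * t' - pi * t) *\<^sub>R v s + sin (pi * t - pi * s) *\<^sub>R v t'"
      proof -
        have "d * cos (pi * t) = sin (pi * t' - pi * t) * cos (pi * s) + sin (pi * t - pi * s) * cos (pi * t')"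
          "d * sin (pi * t) = sin (pi * t' - pi * t) * sin (pi * s) + sin (pi * t - pi * s) * sin (pi * t')"
          by (simp_all add: d_def sin_diff algebra_simps)
        then show ?thesis by (simp add: v_def scaleR_add_right scaleR_diff_right scaleR_add_left scaleR_diff_left)
      qed
      then have "v t = (1 / d) *\<^sub>R (sin (pi * t' - pi * t) *\<^sub>R v s + sin (pi * t - pi * s) *\<^sub>R v t')"
        using d by (metis divide_self_if less_numeral_extra(3) scaleR_one scaleR_scaleR times_divide_eq_left mult_1)
      then have eq: "g t - c = x *\<^sub>R (g s - c) + y *\<^sub>R (g t' - c)"
        using \<rho>(1)[of s] \<rho>(1)[of t'] d by (simp add: \<rho>(2) x_def y_def scaleR_add_right)
      have "1 \<le> x + y"
      proof (rule ccontr)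
        assume "\<not> 1 \<le> x + y"
        then have "c + x *\<^sub>R (g s - c) + y *\<^sub>R (g t' - c) \<in> interior K"
          using xy gK K by (intro mem_interior_triangle) auto
        moreover have "c + x *\<^sub>R (g s - c) + y *\<^sub>R (g t' - c) = g t" using eq by (simp add: algebra_simps)
        ultimately show False using gf by (simp add: frontier_def)
      qed
      then show ?thesis using xy eq by blast
    qed
  qed
qed

section \<open>Cauchy's bound on the length of a convex arc\<close>

text \<open>The numbers are values of a functional, relative to \<open>c\<close>, at successive
  points of the arc. Suppose \<open>a\<close>, \<open>d\<close> are at most \<open>M\<close> and
  \<open>b\<close>, \<open>e\<close> at least \<open>\<mu> > M\<close>. Since the weights sum to at
  least 1, \<open>M \<ge> 0\<close> forces \<open>d \<ge> \<mu>\<close>, and \<open>M < 0\<close>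
  forces \<open>b \<le> M\<close>.\<close>

lemma no_alternation_real:
  fixes a b d e :: real
  assumes "b = x * a + y * d" "0 \<le> x" "0 \<le> y" "1 \<le> x + y"
    and "d = x' * b + y' * e" "0 \<le> x'" "0 \<le> y'" "1 \<le> x' + y'"
  shows "min b e \<le> max a d"
proof (rule ccontr)
  assume *: "\<not> min b e \<le> max a d"
  define M \<mu> where "M = max a d" and "\<mu> = min b e"
  have "M < \<mu>" using * unfolding M_def \<mu>_def by linarith
  show False
  proof (cases "0 \<le> M")
    case True
    have "\<mu> * 1 \<le> \<mu> * (x' + y')" using True \<open>M < \<mu>\<close> assms by (intro mult_left_mono) auto
    also have "\<dots> = x' * \<mu> + y' * \<mu>" by (simp add: algebra_simps)
    also have "\<dots> \<le> x' * b + y' * e"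
      using assms by (intro add_mono mult_left_mono) (auto simp: \<mu>_def)
    finally show False using assms(5) \<open>M < \<mu>\<close> by (simp add: M_def)
  next
    case False
    have "x * a + y * d \<le> x * M + y * M"
      using assms by (intro add_mono mult_left_mono) (auto simp: M_def)
    also have "\<dots> = M * (x + y)" by (simp add: algebra_simps)
    also have "\<dots> \<le> M * 1" using False assms by (intro mult_left_mono_neg) auto
    finally show False using assms(1) \<open>M < \<mu>\<close> by (simp add: \<mu>_def)
  qed
qed

text \<open>Along an inscribed polygon each functional varies by at most twice its oscillation, so
  by at most \<open>2 * B a\<close>. Integrating over directions turns the variation into twice the
  polygon's length.\<close>

lemma curve_length_le_width_integral:
  fixes g :: "real \<Rightarrow> 'a::real_inner"
  assumes nm: "norm n = 1" "norm m = 1" "n \<bullet> m = 0" "\<And>x. x = (x \<bullet> n) *\<^sub>R n + (x \<bullet> m) *\<^sub>R m"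
    and B: "(B has_integral I) {0..pi}"
    and gB: "\<And>a s t. a \<in> {0..pi} \<Longrightarrow> s \<in> {0..1} \<Longrightarrow> t \<in> {0..1} \<Longrightarrow>
      (cos a *\<^sub>R n + sin a *\<^sub>R m) \<bullet> (g s - g t) \<le> B a"
    and conv: "\<And>s t t'. 0 \<le> s \<Longrightarrow> s \<le> t \<Longrightarrow> t \<le> t' \<Longrightarrow> t' \<le> 1 \<Longrightarrow> 0 < s \<or> t' < 1 \<Longrightarrow>
      \<exists>x y. 0 \<le> x \<and> 0 \<le> y \<and> 1 \<le> x + y \<and> g t - c = x *\<^sub>R (g s - c) + y *\<^sub>R (g t' - c)"
  shows "curve_length g \<le> ereal I"
  unfolding curve_length_def
proof (rule SUP_least, clarify)
  fix k :: nat and t :: "nat \<Rightarrow> real"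
  assume mono: "mono_on {..k} t" and t01: "t ` {..k} \<subseteq> {0..1}"
  have tm: "t i \<le> t j" if "i \<le> j" "j \<le> k" for i j using mono that by (auto simp: mono_on_def)
  have t0: "0 \<le> t i" "t i \<le> 1" if "i \<le> k" for i using t01 that by auto
  define d where "d i = g (t (Suc i)) - g (t i)" for i
  have alt: "min (u \<bullet> g (t j)) (u \<bullet> g (t (Suc i))) \<le> max (u \<bullet> g (t 0)) (u \<bullet> g (t i))"
    if ji: "j \<le> i" "i < k" for u i j
  proof (cases "(0 < t 0 \<or> t i < 1) \<and> (0 < t j \<or> t (Suc i) < 1)")
    case True
    have *: "0 \<le> t 0" "t 0 \<le> t j" "t j \<le> t i" "t i \<le> t (Suc i)" "t (Suc i) \<le> 1" "t i \<le> 1" "0 \<le> t j"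
      using ji tm t0 by auto
    obtain x y where xy: "0 \<le> x" "0 \<le> y" "1 \<le> x + y" "g (t j) - c = x *\<^sub>R (g (t 0) - c) + y *\<^sub>R (g (t i) - c)"
      using conv[of "t 0" "t j" "t i"] True * by blast
    obtain x' y' where xy': "0 \<le> x'" "0 \<le> y'" "1 \<le> x' + y'" "g (t i) - c = x' *\<^sub>R (g (t j) - c) + y' *\<^sub>R (g (t (Suc i)) - c)"
      using conv[of "t j" "t i" "t (Suc i)"] True * by blast
    have "min (u \<bullet> (g (t j) - c)) (u \<bullet> (g (t (Suc i)) - c)) \<le> max (u \<bullet> (g (t 0) - c)) (u \<bullet> (g (t i) - c))"
    proof (rule no_alternation_real[OF _ xy(1-3) _ xy'(1-3)])
      show "u \<bullet> (g (t j) - c) = x * (u \<bullet> (g (t 0) - c)) + y * (u \<bullet> (g (t i) - c))"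
        by (simp only: xy(4) inner_add_right inner_scaleR_right)
      show "u \<bullet> (g (t i) - c) = x' * (u \<bullet> (g (t j) - c)) + y' * (u \<bullet> (g (t (Suc i)) - c))"
        by (subst xy'(4)) (simp only: inner_add_right inner_scaleR_right)
    qed
    then show ?thesis unfolding inner_diff_right by linarith
  next
    case False
    \<comment> \<open>Where \<open>conv\<close> fails, the two outer parameters are 0 and 1.
      Monotonicity then makes two of the four sample points coincide, and the claim is
      trivial.\<close>
    then have "t i = 1 \<or> t j = 0 \<and> 0 \<le> t 0"
      using ji t0[of 0] t0[of i] t0[of j] by fastforce
    then have "t (Suc i) = t i \<or> t j = t 0"
      using ji tm[of i "Suc i"] tm[of 0 j] t0[of "Suc i"] by force
    then show ?thesis by auto
  qed
  have var: "(\<Sum>i<k. \<bar>(d i \<bullet> n) * cos a + (d i \<bullet> m) * sin a\<bar>) \<le> 2 * B a" if a: "a \<in> {0..pi}" for a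
  proof -
    define u where "u = cos a *\<^sub>R n + sin a *\<^sub>R m"
    define h where "h i = u \<bullet> g (t i)" for i
    define lo hi where "lo = Min (h ` {..k})" and "hi = Max (h ` {..k})"
    have fin: "finite (h ` {..k})" "h ` {..k} \<noteq> {}" by auto
    have "lo \<in> h ` {..k}" "hi \<in> h ` {..k}" unfolding lo_def hi_def by (intro Min_in Max_in fin)+
    then obtain i j where ij: "i \<le> k" "lo = h i" "j \<le> k" "hi = h j" by auto
    have "hi - lo \<le> B a"
      using gB[OF a, of "t j" "t i"] ij t0 by (simp add: h_def u_def inner_diff_right)
    have "(\<Sum>i<k. \<bar>h (Suc i) - h i\<bar>) + \<bar>h k - h 0\<bar> \<le> 2 * (hi - lo)"
    proof (rule abs_variation_le)
      fix j i assume ji: "j \<le> i" "i < k"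
      show "min (h j) (h (Suc i)) \<le> max (h 0) (h i)"
        using alt[OF ji, of u] by (simp add: h_def)
      \<comment> \<open>Negating the functional exchanges high and low.\<close>
      show "min (h 0) (h i) \<le> max (h j) (h (Suc i))"
        using alt[OF ji, of "- u"] unfolding h_def inner_minus_left by linarith
    qed (auto simp: lo_def hi_def)
    moreover have "(d i \<bullet> n) * cos a + (d i \<bullet> m) * sin a = h (Suc i) - h i" for i
      by (simp add: h_def u_def d_def inner_simps inner_commute algebra_simps)
    ultimately show ?thesis using \<open>hi - lo \<le> B a\<close> by simp
  qed
  have "((\<lambda>a. \<Sum>i<k. \<bar>(d i \<bullet> n) * cos a + (d i \<bullet> m) * sin a\<bar>) has_integral
      (\<Sum>i<k. 2 * sqrt ((d i \<bullet> n)\<^sup>2 + (d i \<bullet> m)\<^sup>2))) {0..pi}"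
    by (intro has_integral_sum has_integral_abs_sin_cos) auto
  then have "((\<lambda>a. \<Sum>i<k. \<bar>(d i \<bullet> n) * cos a + (d i \<bullet> m) * sin a\<bar>) has_integral
      (\<Sum>i<k. 2 * norm (d i))) {0..pi}"
    using norm_orthonormal_coords[OF nm] by simp
  moreover have "((\<lambda>a. 2 * B a) has_integral 2 * I) {0..pi}"
    by (intro has_integral_mult_right B)
  ultimately have "(\<Sum>i<k. 2 * norm (d i)) \<le> 2 * I"
    by (rule has_integral_le) (use var in auto)
  then show "ereal (\<Sum>i<k. dist (g (t i)) (g (t (Suc i)))) \<le> ereal I"
    by (simp add: d_def dist_norm norm_minus_commute flip: sum_distrib_left)
qed

section \<open>Chords contained in the frontier\<close>

lemma curve_length_linepath_le:
  "curve_length (linepath p q) \<le> ereal (dist p q)"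
  unfolding curve_length_def
proof (rule SUP_least, clarify)
  fix k :: nat and t :: "nat \<Rightarrow> real"
  assume mono: "mono_on {..k} t" and t01: "t ` {..k} \<subseteq> {0..1}"
  have "dist (linepath p q (t i)) (linepath p q (t (Suc i))) = (t (Suc i) - t i) * dist p q" if "i < k" for i
  proof -
    have "t i \<le> t (Suc i)" using mono that by (auto simp: mono_on_def)
    moreover have "linepath p q (t i) - linepath p q (t (Suc i)) = (t (Suc i) - t i) *\<^sub>R (p - q)"
      by (simp add: linepath_def algebra_simps)
    ultimately show ?thesis by (simp add: dist_norm)
  qed
  then have "(\<Sum>i<k. dist (linepath p q (t i)) (linepath p q (t (Suc i)))) = (\<Sum>i<k. t (Suc i) - t i) * dist p q"
    by (simp add: sum_distrib_right)
  also have "\<dots> = (t k - t 0) * dist p q" by (simp add: sum_lessThan_telescope)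
  also have "\<dots> \<le> 1 * dist p q"
  proof (rule mult_right_mono)
    have "t k \<in> {0..1}" "t 0 \<in> {0..1}" using t01 by auto
    then show "t k - t 0 \<le> 1" by auto
  qed simp
  finally show "ereal (\<Sum>i<k. dist (linepath p q (t i)) (linepath p q (t (Suc i)))) \<le> ereal (dist p q)"
    by simp
qed

text \<open>If some \<open>x\<close> on the chord were interior, the midpoint of the chord would be
  halfway between \<open>x\<close> and its reflection \<open>p + q - x\<close>, which lies in
  \<open>K\<close>, and hence interior.\<close>

lemma closed_segment_subset_frontier:
  fixes K :: "'a::euclidean_space set"
  assumes "convex K" "closed K" "p \<in> K" "q \<in> K" "midpoint p q \<in> frontier K"
  shows "closed_segment p q \<subseteq> frontier K"
proof -
  have cl: "closed_segment p q \<subseteq> K" using assms by (simp add: closed_segment_subset)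
  have "x \<notin> interior K" if x: "x \<in> closed_segment p q" for x
  proof
    assume xi: "x \<in> interior K"
    have "midpoint p q \<in> interior K"
    proof (cases "x = midpoint p q")
      case False
      define y where "y = p + q - x"
      obtain s where s: "0 \<le> s" "s \<le> 1" "x = (1 - s) *\<^sub>R p + s *\<^sub>R q"
        using x by (auto simp: in_segment)
      have "y = (1 - (1 - s)) *\<^sub>R p + (1 - s) *\<^sub>R q"
        by (simp add: y_def s(3) algebra_simps)
      then have "y \<in> closed_segment p q"
        using s(1,2) unfolding in_segment by (intro exI[of _ "1 - s"]) auto
      then have "y - (1/2) *\<^sub>R (y - x) \<in> interior K"
        using assms(1) xi cl by (intro mem_interior_convex_shrink) auto
      moreover have "midpoint p q = y - (1/2) *\<^sub>R (y - x)"
      proof -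
        define v where "v = y - x"
        have "(1/2) *\<^sub>R v + (1/2) *\<^sub>R v = v" by (simp flip: scaleR_left_distrib)
        then have "(y - (1/2) *\<^sub>R v) + (y - (1/2) *\<^sub>R v) = y + y - v" by (simp add: add_diff_eq diff_add_eq diff_diff_eq)
        also have "\<dots> = p + q" by (simp add: v_def y_def)
        finally show ?thesis by (simp add: midpoint_eq_iff v_def)
      qed
      ultimately show ?thesis by simp
    qed (use xi in simp)
    then show False using assms(5) by (simp add: frontier_def)
  qed
  then show ?thesis using cl assms(2) by (auto simp: frontier_def)
qed

section \<open>The bound for a pair of points and for the dilation\<close>

lemma curve_dist_frontier_le:
  fixes K :: "(real^2) set"
  defines "w \<equiv> width K" and "D \<equiv> diameter K"
  assumes K: "convex K" "compact K" "interior K \<noteq> {}"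
    and pq: "p \<in> frontier K" "q \<in> frontier K" "p \<noteq> q"
  shows "curve_dist (frontier K) p q
    \<le> ereal (dist p q / w * (2 * D * arcsin (w / D) + 2 * sqrt (D\<^sup>2 - w\<^sup>2)))"
proof -
  define l where "l = dist p q"
  define e where "e = (q - p) /\<^sub>R l"
  define c where "c = midpoint p q"
  have l: "0 < l" using pq by (simp add: l_def)
  have e: "norm e = 1" using l by (simp add: e_def l_def dist_norm norm_minus_commute)
  have q: "q = p + l *\<^sub>R e" using l by (simp add: e_def)
  have half: "(l/2) *\<^sub>R e + (l/2) *\<^sub>R e = l *\<^sub>R e" by (simp flip: scaleR_left_distrib)
  have c_eq: "c = p + (l/2) *\<^sub>R e"
    unfolding c_def midpoint_eq_iff q using half by (simp add: ac_simps)
  have pc: "c - (l/2) *\<^sub>R e = p" "c + (l/2) *\<^sub>R e = q"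
    using half by (simp_all add: c_eq q ac_simps)
  have bd: "bounded K" "closed K" "K \<noteq> {}" using K by (auto simp: compact_imp_bounded compact_imp_closed)
  have fK: "frontier K \<subseteq> K" using bd by (simp add: frontier_subset_closed)
  have w0: "0 < w" using width_pos bd K by (simp add: w_def)
  obtain a where a: "a \<in> K" "a + w *\<^sub>R e \<in> K"
    using chord_of_length_width[OF K(1,2) bd(3) e] by (auto simp: w_def)
  have wD: "w \<le> D"
    using diameter_bounded_bound[OF bd(1) a] w0 e by (simp add: D_def dist_norm)
  have le: "curve_dist (frontier K) p q \<le> curve_length g"
    if "arc g" "path_image g \<subseteq> frontier K" "pathstart g = p" "pathfinish g = q" for g
    unfolding curve_dist_def using that by (intro INF_lower) auto
  show ?thesis
  proof (cases "c \<in> frontier K")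
    case True
    \<comment> \<open>Here the chord itself is an arc of the curve, and \<open>sin x \<le> x\<close>
      shows that its length \<open>l\<close> is within the bound.\<close>
    have "curve_dist (frontier K) p q \<le> curve_length (linepath p q)"
      using True pq fK K bd closed_segment_subset_frontier[of K p q]
      by (intro le) (auto simp: c_def arc_linepath)
    also have "\<dots> \<le> ereal l" using curve_length_linepath_le by (simp add: l_def)
    also have "l \<le> l / w * (2 * D * arcsin (w / D) + 2 * sqrt (D\<^sup>2 - w\<^sup>2))"
    proof -
      have "0 < w / D" "w / D \<le> 1" using w0 wD by auto
      then have ar: "sin (arcsin (w / D)) = w / D" "0 \<le> arcsin (w / D)"
        using arcsin_le_arcsin[of 0 "w / D"] by (auto intro!: sin_arcsin simp del: divide_le_eq_1)
      then have "w / D \<le> arcsin (w / D)" using sin_x_le_x by metis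
      then have "w \<le> D * arcsin (w / D)" using w0 wD by (simp add: field_simps)
      moreover have "0 \<le> D * arcsin (w / D)" using ar w0 wD by simp
      moreover have "0 \<le> sqrt (D\<^sup>2 - w\<^sup>2)" using w0 wD by (simp add: power_mono)
      ultimately have "w \<le> 2 * D * arcsin (w / D) + 2 * sqrt (D\<^sup>2 - w\<^sup>2)" by linarith
      then have "l / w * w \<le> l / w * (2 * D * arcsin (w / D) + 2 * sqrt (D\<^sup>2 - w\<^sup>2))"
        using l w0 by (intro mult_left_mono) auto
      then show ?thesis using w0 by simp
    qed
    finally show ?thesis by (simp add: l_def)
  next
    case False
    have "c \<in> closed_segment p q" by (simp add: c_def)
    then have "c \<in> K" using closed_segment_subset[of p K q] fK pq K by blast
    then have c: "c \<in> interior K" using False closure_subset by (auto simp: frontier_def)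
    obtain f0 where f0: "norm f0 = 1" "e \<bullet> f0 = 0" "\<And>x. x = (x \<bullet> e) *\<^sub>R e + (x \<bullet> f0) *\<^sub>R f0"
      using real2_orthonormal_completion[OF e] by blast
    \<comment> \<open>The sign puts the chord of length \<open>w\<close> on the side of the line
      \<open>pq\<close> opposite to \<open>f\<close>, or on the line; the cap considered is the one
      on the side of \<open>f\<close>.\<close>
    define f where "f = (if 0 < (a - p) \<bullet> f0 then - f0 else f0)"
    have f: "norm f = 1" "e \<bullet> f = 0" using f0 by (auto simp: f_def)
    define a1 g0 where "a1 = (a - p) \<bullet> e" and "g0 = - ((a - p) \<bullet> f)"
    have "a - p = a1 *\<^sub>R e - g0 *\<^sub>R f"
      using f0(3)[of "a - p"] by (auto simp: f_def a1_def g0_def)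
    then have a_eq: "a = p + a1 *\<^sub>R e - g0 *\<^sub>R f" by (simp add: algebra_simps)
    have g0: "0 \<le> g0" by (simp add: g0_def f_def)
    have line: "0 \<le> s \<and> s \<le> l" if "p + s *\<^sub>R e \<in> K" for s
    proof -
      have "c + (s - l/2) *\<^sub>R e = p + s *\<^sub>R e" "c + (l/2 - s) *\<^sub>R (- e) = p + s *\<^sub>R e"
        by (simp_all add: c_eq algebra_simps)
      then show ?thesis
        using ray_beyond_frontier[OF K(1) c, of "l/2" e "s - l/2"]
          ray_beyond_frontier[OF K(1) c, of "l/2" "- e" "l/2 - s"] that l pc pq by simp
    qed
    obtain g where g: "arc g" "path_image g \<subseteq> frontier K" "pathstart g = p" "pathfinish g = q"
      and cap: "\<And>t. t \<in> {0..1} \<Longrightarrow> \<exists>x y. 0 \<le> y \<and> g t = c + x *\<^sub>R e + y *\<^sub>R f"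
      and conv: "\<And>s t t'. 0 \<le> s \<Longrightarrow> s \<le> t \<Longrightarrow> t \<le> t' \<Longrightarrow> t' \<le> 1 \<Longrightarrow> 0 < s \<or> t' < 1 \<Longrightarrow>
        \<exists>x y. 0 \<le> x \<and> 0 \<le> y \<and> 1 \<le> x + y \<and> g t - c = x *\<^sub>R (g s - c) + y *\<^sub>R (g t' - c)"
      using cap_arc[OF K(1,2) c e f, of "l/2"] l pq unfolding pc by (metis half_gt_zero)
    have gK: "g t \<in> K" if "t \<in> {0..1}" for t
      using g(2) fK that unfolding path_image_def by blast
    \<comment> \<open>With the first axis normal to a narrowest slab, differences of points of
      \<open>K\<close> have first coordinate at most \<open>w\<close> in absolute value and norm at
      most \<open>D\<close>.\<close>
    obtain n where n: "norm n = 1" "\<And>x y. x \<in> K \<Longrightarrow> y \<in> K \<Longrightarrow> \<bar>n \<bullet> (x - y)\<bar> \<le> w"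
      using width_attained[OF bd(1,3)] unfolding w_def by blast
    obtain m where m: "norm m = 1" "n \<bullet> m = 0" "\<And>x. x = (x \<bullet> n) *\<^sub>R n + (x \<bullet> m) *\<^sub>R m"
      using real2_orthonormal_completion[OF n(1)] by blast
    define u where "u b = cos b *\<^sub>R n + sin b *\<^sub>R m" for b
    have KB: "\<bar>u b \<bullet> (x - y)\<bar> \<le> strip_disc_width D w b" if "x \<in> K" "y \<in> K" "b \<in> {0..pi}" for x y b
    proof -
      have "norm (x - y) \<le> D"
        using diameter_bounded_bound[OF bd(1) that(1,2)] by (simp add: D_def dist_norm)
      then have "sqrt (((x - y) \<bullet> n)\<^sup>2 + ((x - y) \<bullet> m)\<^sup>2) \<le> D"
        using norm_orthonormal_coords[OF n(1) m] by metis
      then have "((x - y) \<bullet> n)\<^sup>2 + ((x - y) \<bullet> m)\<^sup>2 \<le> D\<^sup>2" by (rule sqrt_le_D)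
      then have "\<bar>((x - y) \<bullet> n) * cos b + ((x - y) \<bullet> m) * sin b\<bar> \<le> strip_disc_width D w b"
        using n(2)[OF that(1,2)] that(3) w0 wD
        by (intro strip_disc_width_bound) (auto simp: inner_commute)
      then show ?thesis
        unfolding u_def inner_commute[of _ "x - y"] inner_add_right inner_scaleR_right
        by (simp only: mult.commute)
    qed
    have gB: "u b \<bullet> (g s - g t) \<le> l / w * strip_disc_width D w b"
      if st: "s \<in> {0..1}" "t \<in> {0..1}" and b: "b \<in> {0..pi}" for s t b
    proof (cases "g0 = 0")
      case True
      \<comment> \<open>The chord of length \<open>w\<close> lies on the line \<open>pq\<close>, so
        \<open>w \<le> l\<close> and the width bound for \<open>K\<close> itself is enough.\<close>
      then have "0 \<le> a1" "a1 + w \<le> l"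
      proof -
        have "p + a1 *\<^sub>R e \<in> K" "p + (a1 + w) *\<^sub>R e \<in> K"
          using a True by (simp_all add: a_eq scaleR_add_left add.assoc)
        then show "0 \<le> a1" "a1 + w \<le> l" using line by blast+
      qed
      then have "1 \<le> l / w" using w0 by simp
      moreover have "u b \<bullet> (g s - g t) \<le> strip_disc_width D w b" "0 \<le> strip_disc_width D w b"
        using KB[OF gK[OF st(1)] gK[OF st(2)] b] by linarith+
      ultimately show ?thesis
        using mult_right_mono[of 1 "l / w" "strip_disc_width D w b"] by linarith
    next
      case False
      have hK: "a + (w / l) *\<^sub>R (g r - p) \<in> K" if r: "r \<in> {0..1}" for r
      proof -
        obtain x y where xy: "0 \<le> y" "g r = c + x *\<^sub>R e + y *\<^sub>R f" using cap[OF r] by blast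
        then have "g r = p + (x + l/2) *\<^sub>R e + y *\<^sub>R f"
          by (simp add: c_eq algebra_simps)
        then show ?thesis
          using cap_homothety[OF K(1) l w0 line a a_eq] g0 False gK[OF r] xy(1) by simp
      qed
      \<comment> \<open>The homothetic copy of the cap lies in \<open>K\<close>; scaling its width
        back costs the factor \<open>l / w\<close>.\<close>
      have "u b \<bullet> (g s - g t) = l / w * (u b \<bullet> ((a + (w / l) *\<^sub>R (g s - p)) - (a + (w / l) *\<^sub>R (g t - p))))"
        using l w0 by (simp add: inner_simps field_simps)
      also have "\<dots> \<le> l / w * strip_disc_width D w b"
        using KB[OF hK[OF st(1)] hK[OF st(2)] b] l w0 by (intro mult_left_mono) auto
      finally show ?thesis .
    qed
    have "curve_length g \<le> ereal (l / w * (2 * D * arcsin (w / D) + 2 * sqrt (D\<^sup>2 - w\<^sup>2)))"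
    proof (rule curve_length_le_width_integral[OF n(1) m _ _ conv])
      show "((\<lambda>b. l / w * strip_disc_width D w b) has_integral
          l / w * (2 * D * arcsin (w / D) + 2 * sqrt (D\<^sup>2 - w\<^sup>2))) {0..pi}"
        by (intro has_integral_mult_right has_integral_strip_disc_width w0 wD)
    qed (use gB in \<open>auto simp: u_def\<close>)
    then show ?thesis using le[OF g] by (simp add: l_def)
  qed
qed

theorem theorem9:
  fixes C :: "(real^2) set" and D w :: real
  assumes "closed_convex_curve C"
    and "D = diameter C"
    and "w = width C"
  shows "geometric_dilation C \<le> ereal (2 * (D / w * arcsin (w / D) + sqrt ((D / w)\<^sup>2 - 1)))"
proof -
  obtain K where K: "convex K" "compact K" "interior K \<noteq> {}" and C: "C = frontier K"
    using assms(1) by (auto simp: closed_convex_curve_def)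
  \<comment> \<open>The data of the theorem refer to the curve only; this recovers the body, so that
    width and diameter can be taken of \<open>K\<close>.\<close>
  have hull: "K = convex hull C"
    unfolding C using K by (intro Krein_Milman_frontier) auto
  have w: "w = width K" using assms(3) hull width_convex_hull by metis
  have D: "D = diameter K"
    using assms(2) hull C K(2) diameter_convex_hull_eq by (metis compact_frontier compact_imp_bounded)
  have w0: "0 < w" unfolding w using K by (intro width_pos) (auto simp: compact_imp_bounded)
  have sq: "sqrt (D\<^sup>2 - w\<^sup>2) / w = sqrt ((D / w)\<^sup>2 - 1)"
  proof -
    have "sqrt (D\<^sup>2 - w\<^sup>2) / w = sqrt ((D\<^sup>2 - w\<^sup>2) / w\<^sup>2)"
      using w0 by (simp add: real_sqrt_divide)
    also have "(D\<^sup>2 - w\<^sup>2) / w\<^sup>2 = (D / w)\<^sup>2 - 1"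
      using w0 by (simp add: power_divide diff_divide_distrib)
    finally show ?thesis .
  qed
  show ?thesis
    unfolding geometric_dilation_def
  proof (rule SUP_least, clarify)
    fix p q assume pq: "p \<in> C" "q \<in> C" "p \<noteq> q"
    then have "curve_dist C p q
        \<le> ereal (dist p q / w * (2 * D * arcsin (w / D) + 2 * sqrt (D\<^sup>2 - w\<^sup>2)))"
      unfolding C w D by (intro curve_dist_frontier_le K) auto
    then have "curve_dist C p q / ereal (dist p q)
        \<le> ereal (dist p q / w * (2 * D * arcsin (w / D) + 2 * sqrt (D\<^sup>2 - w\<^sup>2))) / ereal (dist p q)"
      using pq by (intro ereal_divide_right_mono) auto
    also have "\<dots> = ereal (2 * (D / w * arcsin (w / D) + sqrt (D\<^sup>2 - w\<^sup>2) / w))"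
      using pq w0 by (simp add: field_simps)
    finally show "curve_dist C p q / ereal (dist p q)
        \<le> ereal (2 * (D / w * arcsin (w / D) + sqrt ((D / w)\<^sup>2 - 1)))"
      by (simp only: sq)
  qed
qed

end
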